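(* Let $Q(x,y,z)=ax^2+by^2+cz^2$, where $a,b,c$ are positive integers with $\gcd(a,b,c)=1$. Define \[ p_{\min}:=\min\{p\text{ odd prime}\mid p\text{ divides exactly two of }a,b,c\}. \] For each odd prime $q$ dividing exactly one coefficient, let $r_q$ and $s_q$ denote the other two coefficients, and define \[ q_{\min}:=\min\left\{q\text{ odd prime}\;\middle|\; q\text{ divides exactly one of }a,b,c\text{ and }\left(\frac{-r_qs_q}{q}\right)=-1\right\}, \] where $\left(\frac{\cdot}{q}\right)$ is the Legendre symbol and $\min\varnothing=\infty$. Label the coefficients as follows: if exactly two coefficients are even they are called $a,b$, ordered so that $a\equiv2\pmod4$ whenever exactly one of them is $\equiv2\pmod4$; if exactly one coefficient is even it is called $a$. (1) If all of $a,b,c$ are odd, \[ \kappa_Q=\begin{cases}\min\{8,p_{\min}\} & \text{if }a\equiv b\equiv c\pmod4,\\ \min\{p_{\min},q_{\min}^2\} & \text{otherwise}.\end{cases} \] (2) If exactly two of $a,b,c$ are even, \[ \kappa_Q=\begin{cases}\min\{4,p_{\min}\} & \text{if }4\mid a\text{ and }4\mid b,\\ \min\{8,p_{\min}\} & \text{if }a\equiv b\equiv2\pmod4,\text{ or }a\equiv2\pmod4\text{ and }b\equiv0\pmod8,\\ \min\{16,p_{\min},q_{\min}^2\} & \text{if }a\equiv2\pmod4\text{ and }b\equiv4\pmod8.\end{cases} \] (3) If exactly one of $a,b,c$ is even, \[ \kappa_Q=\begin{cases}\min\{4,p_{\min}\} & \text{if }4\mid a,\\ \min\{p_{\min},q_{\min}^2\}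 & \text{if }a\equiv2\pmod4\text{ and }a+b+c\equiv0\pmod8,\text{ or }a\equiv2\pmod4\text{ and }b+c\equiv0\pmod8,\\ \min\{16,p_{\min},q_{\min}^2\} & \text{otherwise}.\end{cases} \]
   Context: For $l\in\mathbb{Z}$ and $k\in\mathbb{Z}_{\ge1}$, write $Q\not\equiv l\pmod k$ if $Q(x,y,z)\not\equiv l\pmod k$ for all $(x,y,z)\in\mathbb{Z}^3$. We say $Q$ has a local obstruction modulo $k$ if there exists $l\in\mathbb{Z}$ with $Q\not\equiv l\pmod k$. The minimal obstruction modulus is $\kappa_Q:=\min\{k\in\mathbb{Z}_{\ge1}\mid Q\text{ has a local obstruction modulo }k\}$, with $\kappa_Q=\infty$ if $Q$ has no local obstruction. Permuting the variables does not change $\kappa_Q$, so the labeling of coefficients in the claim is a convention only. *)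

theory Defs
  imports "HOL-Number_Theory.Number_Theory" "HOL-Library.Extended_Nat" "HOL-Library.Multiset"
begin

definition diag_form :: "int \<Rightarrow> int \<Rightarrow> int \<Rightarrow> int \<Rightarrow> int \<Rightarrow> int \<Rightarrow> int" where
  "diag_form a b c x y z = a * x^2 + b * y^2 + c * z^2"

definition local_obstruction :: "(int \<Rightarrow> int \<Rightarrow> int \<Rightarrow> int) \<Rightarrow> nat \<Rightarrow> bool" where
  "local_obstruction Q k \<longleftrightarrow> (\<exists>l. \<forall>x y z. \<not> [Q x y z = l] (mod int k))"

text \<open>Minima of sets of natural numbers are taken in \<^typ>\<open>enat\<close>, where the infimum of a
  nonempty set is its least element and the infimum of the empty set is \<^term>\<open>\<infinity> :: enat\<close>.\<close>

definition kappa :: "(int \<Rightarrow> int \<Rightarrow> int \<Rightarrow> int) \<Rightarrow> enat" where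
  "kappa Q = (INF k \<in> {k. k \<ge> 1 \<and> local_obstruction Q k}. enat k)"

text \<open>The coefficients are counted with repetition, as entries of a list: a prime dividing
  \<open>a = b\<close> but not \<open>c\<close> divides exactly two of them.\<close>

definition num_divisible :: "int \<Rightarrow> int \<Rightarrow> int \<Rightarrow> int \<Rightarrow> nat" where
  "num_divisible m a b c = length (filter (\<lambda>t. m dvd t) [a, b, c])"

definition p_min :: "int \<Rightarrow> int \<Rightarrow> int \<Rightarrow> enat" where
  "p_min a b c = (INF p \<in> {p. prime p \<and> odd p \<and> num_divisible (int p) a b c = 2}. enat p)"

definition q_min :: "int \<Rightarrow> int \<Rightarrow> int \<Rightarrow> enat" where
  "q_min a b c = (INF q \<in> {q. prime q \<and> odd q \<and> num_divisible (int q) a b c = 1 \<and>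
      (int q dvd a \<and> Legendre (- (b * c)) (int q) = -1 \<or>
       int q dvd b \<and> Legendre (- (a * c)) (int q) = -1 \<or>
       int q dvd c \<and> Legendre (- (a * b)) (int q) = -1)}. enat q)"

end

theory Submission
  imports Defs
begin

text \<open>By the Chinese remainder theorem an obstruction modulo \<open>k\<close> yields one modulo a prime power dividing
  \<open>k\<close>, so only prime powers matter. At an odd prime \<open>p\<close>, a binary form with unit coefficients represents
  every residue modulo \<open>p\<close>, and representations with a unit variable lift by Hensel's lemma: if \<open>p\<close>
  divides no coefficient there is no obstruction; if it divides two, there is one modulo \<open>p\<close>, because a
  multiple of a square misses a class; if it divides only \<open>a\<close>, the form \<open>b y\<^sup>2 + c z\<^sup>2\<close> is either
  isotropic, and there is no obstruction, or anisotropic, and the first obstruction is modulo \<open>p\<^sup>2\<close>.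
  At \<open>2\<close>, Hensel's lemma reduces everything to residues modulo 8 and 16, which are checked
  exhaustively. A two-adic obstruction modulo at most 8 makes \<open>q_min\<close> irrelevant, since
  \<open>q_min\<^sup>2 \<ge> 9\<close>.\<close>

section \<open>Representability modulo m: symmetry, change of modulus, Chinese remainder
  theorem\<close>

definition represents_mod :: "int \<Rightarrow> int \<Rightarrow> int \<Rightarrow> int \<Rightarrow> int \<Rightarrow> bool" where
  "represents_mod m a b c l \<longleftrightarrow> (\<exists>x y z. [diag_form a b c x y z = l] (mod m))"

lemma local_obstruction_diag_form:
  "local_obstruction (diag_form a b c) k \<longleftrightarrow> (\<exists>l. \<not> represents_mod (int k) a b c l)"
  by (simp add: local_obstruction_def represents_mod_def)

lemma represents_modI: "[a * x^2 + b * y^2 + c * z^2 = l] (mod m) \<Longrightarrow> represents_mod m a b c l"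
  unfolding represents_mod_def diag_form_def by blast

lemma represents_modE:
  assumes "represents_mod m a b c l"
  obtains x y z where "[a * x^2 + b * y^2 + c * z^2 = l] (mod m)"
  using assms unfolding represents_mod_def diag_form_def by blast

lemma represents_mod_swap12: "represents_mod m a b c l = represents_mod m b a c l"
proof -
  have "represents_mod m b a c l" if "represents_mod m a b c l" for a b
  proof -
    from that obtain x y z where "[a * x^2 + b * y^2 + c * z^2 = l] (mod m)"
      by (rule represents_modE)
    then show ?thesis
      by (intro represents_modI[of _ y _ x _ z]) (simp add: algebra_simps)
  qed
  then show ?thesis by blast
qed

lemma represents_mod_swap23: "represents_mod m a b c l = represents_mod m a c b l"
proof -
  have "represents_mod m a c b l" if "represents_mod m a b c l" for b c
  proof -
    from that obtain x y z where "[a * x^2 + b * y^2 + c * z^2 = l] (mod m)"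
      by (rule represents_modE)
    then show ?thesis
      by (intro represents_modI[of _ x _ z _ y]) (simp add: algebra_simps)
  qed
  then show ?thesis by blast
qed

lemma represents_mod_cong:
  assumes "[a = a'] (mod m)" "[b = b'] (mod m)" "[c = c'] (mod m)" "[l = l'] (mod m)"
  shows "represents_mod m a b c l = represents_mod m a' b' c' l'"
proof -
  have "represents_mod m a' b' c' l'"
    if r: "represents_mod m a b c l" and e: "[a = a'] (mod m)" "[b = b'] (mod m)" "[c = c'] (mod m)" "[l = l'] (mod m)"
    for a b c l a' b' c' l'
  proof -
    from r obtain x y z where "[a * x^2 + b * y^2 + c * z^2 = l] (mod m)"
      by (rule represents_modE)
    moreover have "[a * x^2 + b * y^2 + c * z^2 = a' * x^2 + b' * y^2 + c' * z^2] (mod m)"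
      using e by (intro cong_add cong_mult cong_refl)
    ultimately show ?thesis
      using e(4) by (meson cong_sym cong_trans represents_modI)
  qed
  from this[OF _ assms] this[OF _ assms[THEN cong_sym]] show ?thesis by blast
qed

lemma represents_mod_dvd:
  assumes "represents_mod n a b c l" "m dvd n"
  shows "represents_mod m a b c l"
  using assms cong_dvd_modulus unfolding represents_mod_def by blast

text \<open>The Chinese remainder theorem glues the two solutions variable by variable.\<close>

lemma represents_mod_coprime_mult:
  assumes "coprime m n" "represents_mod m a b c l" "represents_mod n a b c l"
  shows "represents_mod (m * n) a b c l"
proof -
  from assms(2) obtain x y z where m: "[a * x^2 + b * y^2 + c * z^2 = l] (mod m)"
    by (rule represents_modE)
  from assms(3) obtain x' y' z' where n: "[a * x'^2 + b * y'^2 + c * z'^2 = l] (mod n)"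
    by (rule represents_modE)
  obtain X where X: "[X = x] (mod m)" "[X = x'] (mod n)"
    using binary_chinese_remainder_int[OF assms(1)] by blast
  obtain Y where Y: "[Y = y] (mod m)" "[Y = y'] (mod n)"
    using binary_chinese_remainder_int[OF assms(1)] by blast
  obtain Z where Z: "[Z = z] (mod m)" "[Z = z'] (mod n)"
    using binary_chinese_remainder_int[OF assms(1)] by blast
  have "[a * X^2 + b * Y^2 + c * Z^2 = a * x^2 + b * y^2 + c * z^2] (mod m)"
    using X Y Z by (intro cong_add cong_mult cong_pow cong_refl)
  then have "[a * X^2 + b * Y^2 + c * Z^2 = l] (mod m)"
    using m by (rule cong_trans)
  moreover have "[a * X^2 + b * Y^2 + c * Z^2 = a * x'^2 + b * y'^2 + c * z'^2] (mod n)"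
    using X Y Z by (intro cong_add cong_mult cong_pow cong_refl)
  then have "[a * X^2 + b * Y^2 + c * Z^2 = l] (mod n)"
    using n by (rule cong_trans)
  ultimately have "[a * X^2 + b * Y^2 + c * Z^2 = l] (mod (m * n))"
    using assms(1) by (simp add: coprime_cong_mult)
  then show ?thesis by (rule represents_modI)
qed

text \<open>Strong induction on \<open>k\<close>: split off the full power of one prime. By the
  Chinese remainder theorem the obstruction sits at that power or at the strictly smaller
  cofactor.\<close>

lemma local_obstruction_prime_power:
  assumes "k \<ge> 1" "local_obstruction (diag_form a b c) k"
  shows "\<exists>p e. prime p \<and> p ^ e dvd k \<and> local_obstruction (diag_form a b c) (p ^ e)"
  using assms
proof (induction k rule: less_induct)
  case (less k)
  have "k \<noteq> 1"
    using less.prems by (auto simp: local_obstruction_def)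
  then obtain p where p: "prime p" "p dvd k"
    using prime_factor_nat by blast
  then have "\<exists>p\<in>prime_factors k. True" "k \<noteq> 0"
    using less.prems by (auto simp: prime_factors_dvd)
  then obtain p e n where pe: "prime p" "\<not> p dvd n" "e > 0" "k = p ^ e * n"
    using divide_out_primepow_ex[of k "\<lambda>_. True"] by metis
  have "1 < p ^ e"
    using pe by (intro one_less_power prime_gt_1_nat)
  then have n: "n \<ge> 1" "n < k"
    using pe less.prems by (auto simp: Suc_le_eq intro!: Nat.gr0I)
  have "coprime (int (p ^ e)) (int n)"
    using pe by (simp add: coprime_int_iff prime_imp_coprime del: of_nat_power)
  moreover obtain l where "\<not> represents_mod (int (p ^ e) * int n) a b c l"
    using less.prems(2) pe(4) by (auto simp: local_obstruction_diag_form)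
  ultimately have "local_obstruction (diag_form a b c) (p ^ e) \<or> local_obstruction (diag_form a b c) n"
    using represents_mod_coprime_mult unfolding local_obstruction_diag_form by blast
  then show ?case
  proof
    assume "local_obstruction (diag_form a b c) (p ^ e)"
    then show ?thesis using pe by (meson dvd_triv_left)
  next
    assume "local_obstruction (diag_form a b c) n"
    from less.IH[OF n(2,1) this] show ?thesis
      using pe(4) by (metis dvd_mult)
  qed
qed

subsection \<open>Lifting to prime powers\<close>

text \<open>Newton iteration: the derivative \<open>2 * c * w\<close> is a unit modulo
  \<open>p\<close>, so an approximate root can be corrected at the next power. The induction carries
  \<open>\<not> p dvd w\<close> to keep the derivative a unit.\<close>

lemma hensel_square_odd:
  fixes p :: int
  assumes p: "prime p" "odd p" and "\<not> p dvd c" "\<not> p dvd z" "[c * z^2 = n] (mod p)"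
  shows "\<exists>w. [c * w^2 = n] (mod p ^ k)"
proof -
  have "\<exists>w. \<not> p dvd w \<and> [c * w^2 = n] (mod p ^ Suc k)"
  proof (induction k)
    case 0
    then show ?case using assms by auto
  next
    case (Suc k)
    then obtain w where w: "\<not> p dvd w" "[n = c * w^2] (mod p ^ Suc k)"
      by (auto simp: cong_sym_eq)
    then obtain t where t: "c * w^2 = n + p ^ Suc k * t"
      by (auto simp: cong_iff_lin)
    have "\<not> p dvd 2"
      using p prime_ge_2_int[of p] zdvd_imp_le[of p 2] by (auto simp: order_le_less)
    then have "\<not> p dvd 2 * c * w"
      using w assms by (simp add: prime_dvd_mult_iff)
    then have "coprime (2 * c * w) p"
      by (metis p(1) prime_imp_coprime coprime_commute)
    then obtain r where "[2 * c * w * r = 1] (mod p)"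
      using cong_solve_coprime_int by blast
    then have "[2 * c * w * r * (- t) = 1 * (- t)] (mod p)"
      by (rule cong_scalar_right)
    then obtain u where u: "2 * c * w * (r * t) = t + p * u"
      by (auto simp: cong_iff_lin algebra_simps)
    \<comment> \<open>Since \<open>r\<close> inverts \<open>2 * c * w\<close> modulo
      \<open>p\<close>, the linear term cancels the error \<open>p ^ Suc k * t\<close> modulo the
      next power, where the quadratic term vanishes anyway.\<close>
    let ?w = "w - p ^ Suc k * (r * t)"
    have "c * ?w^2 = c * w^2 - p ^ Suc k * (2 * c * w * (r * t)) + c * (p ^ Suc k)^2 * (r * t)^2"
      by (simp add: power2_eq_square algebra_simps)
    also have "\<dots> = n + p ^ Suc (Suc k) * (c * p ^ k * (r * t)^2 - u)"
      unfolding t u by (simp add: power2_eq_square algebra_simps)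
    finally have "[c * ?w^2 = n] (mod p ^ Suc (Suc k))"
      by (simp add: cong_iff_dvd_diff)
    moreover have "\<not> p dvd ?w"
      using w(1) by (simp add: dvd_diff_left_iff mult.assoc)
    ultimately show ?case by blast
  qed
  then obtain w where "[c * w^2 = n] (mod p ^ Suc k)" by blast
  then show ?thesis
    by (meson cong_dvd_modulus le_imp_power_dvd le_SucI order_refl)
qed

text \<open>The derivative \<open>2 * c * w\<close> has exactly one factor 2, so a correction by a
  multiple of \<open>2 ^ (k + 2)\<close> repairs an error at \<open>2 ^ (k + 3)\<close>. Starting at
  8 makes the quadratic term divisible by \<open>2 ^ (k + 4)\<close>.\<close>

lemma hensel_square_two:
  fixes c z n :: int
  assumes "odd c" "odd z" "[c * z^2 = n] (mod 8)"
  shows "\<exists>w. [c * w^2 = n] (mod 2 ^ k)"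
proof -
  have "\<exists>w. odd w \<and> [c * w^2 = n] (mod 2 ^ (k + 3))"
  proof (induction k)
    case 0
    then show ?case using assms by auto
  next
    case (Suc k)
    then obtain w where w: "odd w" "[n = c * w^2] (mod 2 ^ (k + 3))"
      by (auto simp: cong_sym_eq)
    then obtain t where t: "c * w^2 = n + 2 ^ (k + 3) * t"
      by (auto simp: cong_iff_lin)
    have "even (1 + c * w)"
      using w(1) assms(1) by simp
    \<comment> \<open>In this form the linear term contributes \<open>- 2 ^ (k + 3) * t\<close>,
      which cancels the error, and a multiple of \<open>2 ^ (k + 4)\<close>.\<close>
    then obtain u where u: "c * w = 2 * u - 1"
      by (metis add_diff_cancel_left' evenE)
    let ?w = "w + 2 ^ (k + 2) * t"
    have "c * ?w^2 = c * w^2 + (c * w) * (2 ^ (k + 3) * t) + c * (2 ^ (k + 2))^2 * t^2"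
      by (simp add: power2_eq_square algebra_simps power_add)
    also have "\<dots> = n + 2 ^ (Suc k + 3) * (u * t + c * 2 ^ k * t^2)"
      unfolding t u by (simp add: power2_eq_square algebra_simps power_add)
    finally have "[c * ?w^2 = n] (mod 2 ^ (Suc k + 3))"
      by (simp add: cong_iff_dvd_diff)
    moreover have "odd ?w"
      using w(1) by simp
    ultimately show ?case by blast
  qed
  then obtain w where "[c * w^2 = n] (mod 2 ^ (k + 3))" by blast
  then show ?thesis
    by (meson cong_dvd_modulus le_imp_power_dvd le_add1)
qed

text \<open>Freeze \<open>x\<close> and \<open>y\<close> and lift only \<open>z\<close>.\<close>

lemma represents_mod_lift_odd:
  fixes p :: int
  assumes "prime p" "odd p" "[a * x^2 + b * y^2 + c * z^2 = l] (mod p)" "\<not> p dvd c" "\<not> p dvd z"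
  shows "represents_mod (p ^ k) a b c l"
proof -
  have "[c * z^2 = l - (a * x^2 + b * y^2)] (mod p)"
    using assms(3) by (simp add: cong_iff_dvd_diff algebra_simps)
  then obtain w where "[c * w^2 = l - (a * x^2 + b * y^2)] (mod p ^ k)"
    using hensel_square_odd assms by blast
  then show ?thesis
    by (intro represents_modI[of _ x _ y _ w]) (simp add: cong_iff_dvd_diff algebra_simps)
qed

lemma represents_mod_lift_two:
  assumes "[a * x^2 + b * y^2 + c * z^2 = l] (mod 8)" "odd c" "odd z"
  shows "represents_mod (2 ^ k) a b c l"
proof -
  have "[c * z^2 = l - (a * x^2 + b * y^2)] (mod 8)"
    using assms(1) by (simp add: cong_iff_dvd_diff algebra_simps)
  then obtain w where "[c * w^2 = l - (a * x^2 + b * y^2)] (mod 2 ^ k)"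
    using hensel_square_two assms by blast
  then show ?thesis
    by (intro represents_modI[of _ x _ y _ w]) (simp add: cong_iff_dvd_diff algebra_simps)
qed

text \<open>Halving the congruence makes the coefficient of \<open>z\<close> odd but turns the
  modulus 16 into 8, the precision at which lifting starts.\<close>

lemma represents_mod_lift_two_even:
  assumes "[a * x^2 + b * y^2 + c * z^2 = l] (mod 16)" "[c = 2] (mod 4)" "odd z"
  shows "represents_mod (2 ^ k) a b c l"
proof -
  have "c mod 4 = 2"
    using assms(2) by (simp add: cong_def)
  then have "c = 2 * (c div 2) \<and> odd (c div 2)"
    by presburger
  then obtain d where d: "c = 2 * d" "odd d" by blast
  have e: "[c * z^2 = l - (a * x^2 + b * y^2)] (mod 16)"
    using assms(1) by (simp add: cong_iff_dvd_diff algebra_simps)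
  then have "even (l - (a * x^2 + b * y^2))"
    using d cong_dvd_modulus[OF e, of 2] by (auto dest: cong_dvd_iff)
  then obtain n where n: "l - (a * x^2 + b * y^2) = 2 * n" by blast
  have "2 * 8 dvd 2 * (d * z^2 - n)"
    using e unfolding n d by (simp add: cong_iff_dvd_diff right_diff_distrib mult.assoc)
  then have "[d * z^2 = n] (mod 8)"
    unfolding cong_iff_dvd_diff by (subst (asm) dvd_mult_cancel_left) simp
  then obtain w where "[d * w^2 = n] (mod 2 ^ k)"
    using hensel_square_two d assms by blast
  then have "[c * w^2 = l - (a * x^2 + b * y^2)] (mod 2 ^ k)"
    unfolding n d mult.assoc by (rule cong_scalar_left)
  then show ?thesis
    by (intro represents_modI[of _ x _ y _ w]) (simp add: cong_iff_dvd_diff algebra_simps)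
qed

subsection \<open>Odd primes\<close>

text \<open>Pigeonhole: the sets \<open>{a x\<^sup>2}\<close> and \<open>{t - b y\<^sup>2}\<close> each have \<open>(p + 1) / 2\<close> residues.\<close>

lemma binary_form_represents_mod_prime:
  fixes p :: int
  assumes p: "prime p" "odd p" and "\<not> p dvd a" "\<not> p dvd b"
  shows "\<exists>x y. [a * x^2 + b * y^2 = t] (mod p)"
proof -
  \<comment> \<open>One residue from each pair \<open>x\<close>, \<open>- x\<close>, so that
    squaring is injective modulo \<open>p\<close> on this set.\<close>
  define I where "I = {0..(p - 1) div 2}"
  have p0: "p > 0" using p(1) by (rule prime_gt_0_int)
  have inj: "inj_on (\<lambda>x. (s + d * x^2) mod p) I" if d: "\<not> p dvd d" for s d
  proof (rule inj_onI)
    fix x y assume xy: "x \<in> I" "y \<in> I" "(s + d * x^2) mod p = (s + d * y^2) mod p"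
    then have "p dvd d * ((x - y) * (x + y))"
      by (simp add: mod_eq_dvd_iff power2_eq_square algebra_simps)
    then have "p dvd x - y \<or> p dvd x + y"
      using d p by (simp add: prime_dvd_mult_iff)
    moreover have "0 \<le> x + y" "x + y < p" "\<bar>x - y\<bar> < p"
      using xy by (auto simp: I_def)
    ultimately have "x + y = 0 \<or> x - y = 0"
      using zdvd_imp_le[of p "x + y"] dvd_imp_le_int[of "x - y" p] p0 by fastforce
    then show "x = y"
      using xy by (auto simp: I_def)
  qed
  let ?A = "(\<lambda>x. (0 + a * x^2) mod p) ` I" and ?B = "(\<lambda>y. (t + (- b) * y^2) mod p) ` I"
  have "card ?A + card ?B = 2 * card I"
    using inj[of a 0] inj[of "- b" t] assms by (simp add: card_image)
  also have "int \<dots> = p + 1"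
    using p p0 by (simp add: I_def)
  finally have "int (card ?A + card ?B) > int (card {0..<p})"
    using p0 by simp
  moreover have "?A \<union> ?B \<subseteq> {0..<p}"
    using p0 by auto
  then have "card (?A \<union> ?B) \<le> card {0..<p}"
    by (intro card_mono) auto
  moreover have "finite ?A" "finite ?B"
    by (auto simp: I_def)
  ultimately have "?A \<inter> ?B \<noteq> {}"
    using card_Un_disjoint[of ?A ?B] by linarith
  then obtain x y where "(0 + a * x^2) mod p = (t + (- b) * y^2) mod p" by blast
  then have "[a * x^2 + b * y^2 = t] (mod p)"
    by (simp add: cong_iff_dvd_diff mod_eq_dvd_iff algebra_simps)
  then show ?thesis by blast
qed

text \<open>Otherwise squaring would permute the residues modulo \<open>p\<close>; but 1 and
  \<open>p - 1\<close> have the same square and differ because \<open>p > 2\<close>.\<close>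

lemma quadratic_nonresidue_exists:
  fixes p :: int
  assumes "prime p" "odd p"
  shows "\<exists>n. \<not> QuadRes p n"
proof (rule ccontr)
  assume "\<not> (\<exists>n. \<not> QuadRes p n)"
  then have q: "QuadRes p n" for n by blast
  have p2: "p > 2"
    using assms prime_ge_2_int[of p] by (auto simp: order_le_less)
  let ?f = "\<lambda>x. x^2 mod p"
  have "?f ` {0..<p} = {0..<p}"
  proof
    show "{0..<p} \<subseteq> ?f ` {0..<p}"
    proof
      fix n assume n: "n \<in> {0..<p}"
      obtain x where "[x^2 = n] (mod p)"
        using q[of n] by (auto simp: QuadRes_def)
      then have "(x mod p)^2 mod p = n"
        using n by (simp add: cong_def power_mod)
      then show "n \<in> ?f ` {0..<p}"
        using p2 by (intro image_eqI[of _ _ "x mod p"]) auto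
    qed
  qed (use p2 in auto)
  then have "inj_on ?f {0..<p}"
    by (intro eq_card_imp_inj_on) auto
  moreover have "?f 1 = ?f (p - 1)"
    by (simp add: mod_eq_dvd_iff power2_eq_square algebra_simps)
  ultimately show False
    using p2 by (auto dest!: inj_onD[where x = 1 and y = "p - 1"])
qed

text \<open>Fixing \<open>z = 1\<close> and solving the binary form for \<open>l - c\<close>
  guarantees an invertible variable for Hensel lifting, even when \<open>p\<close> divides
  \<open>l\<close>.\<close>

lemma represents_mod_prime_power_unit:
  fixes p :: int
  assumes "prime p" "odd p" "\<not> p dvd a" "\<not> p dvd b" "\<not> p dvd c"
  shows "represents_mod (p ^ k) a b c l"
proof -
  obtain x y where "[a * x^2 + b * y^2 = l - c] (mod p)"
    using binary_form_represents_mod_prime assms by blast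
  then have "[a * x^2 + b * y^2 + c * 1^2 = l] (mod p)"
    by (simp add: cong_iff_dvd_diff algebra_simps)
  then show ?thesis
    using assms by (intro represents_mod_lift_odd[where z = 1]) (auto dest: not_prime_unit)
qed

text \<open>Take \<open>x = 0\<close>. A target divisible by \<open>p\<close> is reached from an
  isotropic vector of the binary form; any other target forces \<open>y\<close> or \<open>z\<close>
  to be a unit. Either way Hensel lifting applies.\<close>

lemma represents_mod_prime_power_isotropic:
  fixes p :: int
  assumes p: "prime p" "odd p" and bc: "\<not> p dvd b" "\<not> p dvd c" and "QuadRes p (- (b * c))"
  shows "represents_mod (p ^ k) a b c l"
proof (cases "p dvd l")
  case True
  obtain y where "[y^2 = - (b * c)] (mod p)"
    using assms by (auto simp: QuadRes_def)
  \<comment> \<open>The vector \<open>(y, b)\<close> is a zero of the binary form modulo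
    \<open>p\<close>, and its second coordinate is a unit.\<close>
  then have "[b * y^2 + c * b^2 = b * (- (b * c)) + c * b^2] (mod p)"
    by (intro cong_add cong_scalar_left) auto
  also have "b * (- (b * c)) + c * b^2 = 0"
    by (simp add: power2_eq_square)
  finally have "[a * 0^2 + b * y^2 + c * b^2 = l] (mod p)"
    using True by (simp add: cong_0_iff cong_iff_dvd_diff)
  then show ?thesis
    using p bc by (intro represents_mod_lift_odd)
next
  case False
  obtain y z where yz: "[b * y^2 + c * z^2 = l] (mod p)"
    using binary_form_represents_mod_prime assms by blast
  then have "[a * 0^2 + b * y^2 + c * z^2 = l] (mod p)" "[a * 0^2 + c * z^2 + b * y^2 = l] (mod p)"
    by (simp_all add: add.commute)
  moreover have "\<not> p dvd y \<or> \<not> p dvd z"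
    using cong_dvd_iff[OF yz] False by (auto simp: power2_eq_square)
  ultimately have "represents_mod (p ^ k) a b c l \<or> represents_mod (p ^ k) a c b l"
    using represents_mod_lift_odd[OF p _ bc(2)] represents_mod_lift_odd[OF p _ bc(1)] by blast
  then show ?thesis
    by (simp add: represents_mod_swap23)
qed

text \<open>If \<open>z\<close> were invertible, \<open>b * y / z\<close> would be a square root of
  \<open>- (b * c)\<close> modulo \<open>p\<close>.\<close>

lemma anisotropic_binary_form_dvd:
  fixes p :: int
  assumes p: "prime p" and bc: "\<not> p dvd b" "\<not> p dvd c" and n: "\<not> QuadRes p (- (b * c))"
    and yz: "p dvd b * y^2 + c * z^2"
  shows "p dvd y \<and> p dvd z"
proof -
  have z: "p dvd z"
  proof (rule ccontr)
    assume "\<not> p dvd z"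
    then have "coprime z p"
      using p by (metis prime_imp_coprime coprime_commute)
    then obtain r where r: "[z * r = 1] (mod p)"
      using cong_solve_coprime_int by blast
    have "[(b * y * r)^2 = b * r^2 * (b * y^2 + c * z^2) + - (b * c) * (z * r)^2] (mod p)"
      by (simp add: power2_eq_square algebra_simps)
    also have "[b * r^2 * (b * y^2 + c * z^2) + - (b * c) * (z * r)^2 = b * r^2 * 0 + - (b * c) * 1^2] (mod p)"
      using r yz by (intro cong_add cong_mult cong_pow cong_refl) (auto simp: cong_0_iff)
    finally show False
      using n by (auto simp: QuadRes_def)
  qed
  then have "p dvd b * y^2"
    using yz by (simp add: dvd_add_left_iff power2_eq_square)
  then show ?thesis
    using z p bc by (simp add: prime_dvd_mult_iff prime_dvd_power_iff)
qed

text \<open>At a target \<open>p * m\<close>, anisotropy makes \<open>y\<close> and \<open>z\<close>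
  divisible by \<open>p\<close>, so their terms vanish modulo \<open>p^2\<close>. With
  \<open>a = p * d\<close> there remains \<open>d * x^2\<close> congruent to \<open>m\<close> modulo
  \<open>p\<close>.\<close>

lemma not_represents_mod_square:
  fixes p :: int
  assumes p: "prime p" and a: "p dvd a" and bc: "\<not> p dvd b" "\<not> p dvd c" and n: "\<not> QuadRes p (- (b * c))"
  shows "\<exists>l. \<not> represents_mod (p^2) a b c l"
proof -
  obtain d where d: "a = p * d" using a by blast
  \<comment> \<open>A class missed by \<open>d * x^2\<close>: a unit if \<open>p\<close> divides
    \<open>d\<close>, and otherwise \<open>d\<close> times the nonresidue
    \<open>- (b * c)\<close>.\<close>
  define m where "m = (if p dvd d then 1 else - (d * b * c))"
  have p0: "p \<noteq> 0" "\<not> p dvd 1" using p by auto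
  have "\<not> represents_mod (p^2) a b c (p * m)"
  proof
    assume "represents_mod (p^2) a b c (p * m)"
    then obtain x y z where xyz: "p^2 dvd a * x^2 + b * y^2 + c * z^2 - p * m"
      by (auto elim!: represents_modE simp: cong_iff_dvd_diff)
    then have "p dvd p * (d * x^2 - m) + (b * y^2 + c * z^2)"
      unfolding d by (auto simp: power2_eq_square algebra_simps dest: dvd_mult_left)
    then have "p dvd b * y^2 + c * z^2"
      by (simp add: dvd_add_right_iff)
    then obtain y' z' where "y = p * y'" "z = p * z'"
      using anisotropic_binary_form_dvd[OF p bc n] by blast
    then have "p^2 dvd p * (d * x^2 - m) + p^2 * (b * y'^2 + c * z'^2)"
      using xyz by (simp add: d power2_eq_square algebra_simps)
    then have "p^2 dvd p * (d * x^2 - m)"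
      by (simp add: dvd_add_left_iff)
    then have *: "p dvd d * x^2 - m"
      using p0 by (simp add: power2_eq_square)
    show False
    proof (cases "p dvd d")
      case True
      then show False
        using * p0 by (simp add: m_def dvd_diff_right_iff)
    next
      case False
      then have "p dvd d * (x^2 - - (b * c))"
        using * by (simp add: m_def algebra_simps)
      then have "[x^2 = - (b * c)] (mod p)"
        using False p by (simp add: prime_dvd_mult_iff cong_iff_dvd_diff)
      then show False using n by (auto simp: QuadRes_def)
    qed
  qed
  then show ?thesis by blast
qed

text \<open>Modulo \<open>p\<close> only \<open>c * z^2\<close> survives, and it misses
  \<open>c\<close> times a nonresidue.\<close>

lemma not_represents_mod_prime:
  fixes p :: int
  assumes p: "prime p" "odd p" and ab: "p dvd a" "p dvd b" and c: "\<not> p dvd c"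
  shows "\<exists>l. \<not> represents_mod p a b c l"
proof -
  obtain n where n: "\<not> QuadRes p n"
    using quadratic_nonresidue_exists[OF p] by blast
  have "\<not> represents_mod p a b c (c * n)"
  proof
    assume "represents_mod p a b c (c * n)"
    then obtain x y z where "p dvd a * x^2 + b * y^2 + c * z^2 - c * n"
      by (auto elim!: represents_modE simp: cong_iff_dvd_diff)
    then have "p dvd (a * x^2 + b * y^2) + c * (z^2 - n)"
      by (simp add: algebra_simps)
    moreover have "p dvd a * x^2 + b * y^2"
      using ab by simp
    ultimately have "p dvd c * (z^2 - n)"
      using dvd_add_right_iff by blast
    then have "[z^2 = n] (mod p)"
      using c p by (simp add: prime_dvd_mult_iff cong_iff_dvd_diff)
    then show False using n by (auto simp: QuadRes_def)
  qed
  then show ?thesis by blast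
qed

subsection \<open>Powers of two\<close>

lemma mod_16_cases: "(a::int) mod 16 \<in> {0,1,2,3,4,5,6,7,8,9,10,11,12,13,14,15}"
proof -
  have "{0..15::int} = {0,1,2,3,4,5,6,7,8,9,10,11,12,13,14,15}"
    by code_simp
  moreover have "a mod 16 \<in> {0..15}"
    using pos_mod_bound[of 16 a] pos_mod_sign[of 16 a] by simp
  ultimately show ?thesis by metis
qed

lemma square_residue_mod_16:
  fixes x :: int
  obtains y where "y \<in> {0,1,2,3}" "[x^2 = y^2] (mod 16)" "odd y = odd x"
proof -
  have "\<forall>r\<in>{0,1,2,3,4,5,6,7,8,9,10,11,12,13,14,15::int}. \<exists>y\<in>{0,1,2,3}. r^2 mod 16 = y^2 mod 16 \<and> odd y = odd r"
    by code_simp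
  from bspec[OF this mod_16_cases[of x]] obtain y where "y \<in> {0,1,2,3}" "(x mod 16)^2 mod 16 = y^2 mod 16" "odd y = odd (x mod 16)"
    by blast
  then show ?thesis
    using that by (simp add: cong_def power_mod dvd_mod_iff)
qed

lemma not_represents_modI:
  assumes m: "m dvd 16"
    and "\<forall>x\<in>{0,1,2,3}. \<forall>y\<in>{0,1,2,3}. \<forall>z\<in>{0,1,2,3}. (a * x^2 + b * y^2 + c * z^2 - l) mod m \<noteq> 0"
  shows "\<not> represents_mod m a b c l"
proof
  assume "represents_mod m a b c l"
  then obtain x y z where xyz: "[a * x^2 + b * y^2 + c * z^2 = l] (mod m)"
    by (rule represents_modE)
  obtain x' where x': "x' \<in> {0,1,2,3}" "[x'^2 = x^2] (mod m)"
    using square_residue_mod_16[of x] cong_dvd_modulus m cong_sym by metis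
  obtain y' where y': "y' \<in> {0,1,2,3}" "[y'^2 = y^2] (mod m)"
    using square_residue_mod_16[of y] cong_dvd_modulus m cong_sym by metis
  obtain z' where z': "z' \<in> {0,1,2,3}" "[z'^2 = z^2] (mod m)"
    using square_residue_mod_16[of z] cong_dvd_modulus m cong_sym by metis
  have "[a * x'^2 + b * y'^2 + c * z'^2 = a * x^2 + b * y^2 + c * z^2] (mod m)"
    using x' y' z' by (intro cong_add cong_mult cong_refl)
  then have "[a * x'^2 + b * y'^2 + c * z'^2 = l] (mod m)"
    using xyz by (rule cong_trans)
  then show False
    using assms(2)[THEN bspec, OF x'(1), THEN bspec, OF y'(1), THEN bspec, OF z'(1)]
    by (simp add: cong_iff_dvd_diff dvd_eq_mod_eq_0)
qed

text \<open>By \<open>square_residue_mod_16\<close> variables in \<open>{0, 1, 2, 3}\<close> suffice modulo every divisor of 16. In the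
  lifting lemmas the odd variable has a coefficient that is odd or, modulo 16, twice an odd number, so
  that Hensel's lemma applies to it.\<close>

lemma residues_obstruction_4:
  "\<forall>a\<in>{0::int}. \<forall>b\<in>{0,1,3}. \<forall>c\<in>{1,3}.
     (\<exists>l\<in>{0,1,2,3}. \<forall>x\<in>{0,1,2,3}. \<forall>y\<in>{0,1,2,3}. \<forall>z\<in>{0,1,2,3}.
       (a * x^2 + b * y^2 + c * z^2 - l) mod 4 \<noteq> 0)"
  by code_simp

lemma residues_represented_4_two_even:
  "\<forall>a\<in>{2::int}. \<forall>b\<in>{0,1,2,3}. \<forall>c\<in>{1,3}.
     (\<forall>l\<in>{0,1,2,3}. \<exists>x\<in>{0,1,2,3}. \<exists>y\<in>{0,1,2,3}. \<exists>z\<in>{0,1,2,3}.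
       (a * x^2 + b * y^2 + c * z^2 - l) mod 4 = 0)"
  by code_simp

lemma residues_represented_4_odd:
  "\<forall>a\<in>{1,3::int}. \<forall>b\<in>{1,3}. \<forall>c\<in>{1,3}. a = b \<and> b = c \<longrightarrow>
     (\<forall>l\<in>{0,1,2,3}. \<exists>x\<in>{0,1,2,3}. \<exists>y\<in>{0,1,2,3}. \<exists>z\<in>{0,1,2,3}.
       (a * x^2 + b * y^2 + c * z^2 - l) mod 4 = 0)"
  by code_simp

text \<open>An odd value with just one odd variable is congruent to \<open>a\<close> modulo 4. The
  class \<open>- a\<close> modulo 4 needs three odd variables, which give only
  \<open>a + b + c\<close> modulo 8; hence \<open>a + b + c + 4\<close> is missed.\<close>

lemma residues_obstruction_8_odd:
  "\<forall>a\<in>{1,3,5,7::int}. \<forall>b\<in>{1,3,5,7}. \<forall>c\<in>{1,3,5,7}. a mod 4 = b mod 4 \<and> b mod 4 = c mod 4 \<longrightarrow>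
     (\<exists>l\<in>{1,3,5,7}. \<forall>x\<in>{0,1,2,3}. \<forall>y\<in>{0,1,2,3}. \<forall>z\<in>{0,1,2,3}.
       (a * x^2 + b * y^2 + c * z^2 - l) mod 8 \<noteq> 0)"
  by code_simp

text \<open>The odd values are \<open>c\<close>, \<open>c + a\<close>, \<open>c + b\<close> and
  \<open>c + a + b\<close> modulo 8. As \<open>b\<close> is 0, \<open>a\<close> or
  \<open>- a\<close> modulo 8, two of them coincide and an odd class is missed.\<close>

lemma residues_obstruction_8_two_even:
  "\<forall>a\<in>{2,6::int}. \<forall>b\<in>{0,2,6}. \<forall>c\<in>{1,3,5,7}.
     (\<exists>l\<in>{0,1,2,3,4,5,6,7}. \<forall>x\<in>{0,1,2,3}. \<forall>y\<in>{0,1,2,3}. \<forall>z\<in>{0,1,2,3}.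
       (a * x^2 + b * y^2 + c * z^2 - l) mod 8 \<noteq> 0)"
  by code_simp

lemma residues_represented_8_two_even:
  "\<forall>a\<in>{2,6::int}. \<forall>b\<in>{4}. \<forall>c\<in>{1,3,5,7}.
     (\<forall>l\<in>{0,1,2,3,4,5,6,7}. \<exists>x\<in>{0,1,2,3}. \<exists>y\<in>{0,1,2,3}. \<exists>z\<in>{0,1,2,3}.
       (a * x^2 + b * y^2 + c * z^2 - l) mod 8 = 0)"
  by code_simp

lemma residues_represented_8_one_even:
  "\<forall>a\<in>{2,6::int}. \<forall>b\<in>{1,3,5,7}. \<forall>c\<in>{1,3,5,7}.
     \<not> ((a + b + c) mod 8 = 0 \<or> (b + c) mod 8 = 0) \<longrightarrow>
     (\<forall>l\<in>{0,1,2,3,4,5,6,7}. \<exists>x\<in>{0,1,2,3}. \<exists>y\<in>{0,1,2,3}. \<exists>z\<in>{0,1,2,3}.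
       (a * x^2 + b * y^2 + c * z^2 - l) mod 8 = 0)"
  by code_simp

lemma residues_lift_8:
  "\<forall>a\<in>{1,3,5,7::int}. \<forall>b\<in>{1,3,5,7}. \<forall>c\<in>{1,3,5,7}. \<not> (a mod 4 = b mod 4 \<and> b mod 4 = c mod 4) \<longrightarrow>
     (\<forall>l\<in>{0,1,2,3,4,5,6,7}. \<exists>x\<in>{0,1,2,3}. \<exists>y\<in>{0,1,2,3}. \<exists>z\<in>{0,1,2,3}.
       (a * x^2 + b * y^2 + c * z^2 - l) mod 8 = 0 \<and> (odd x \<or> odd y \<or> odd z))"
  by code_simp

text \<open>For \<open>l\<close> congruent to 2 modulo 4, \<open>x\<close> is odd and
  \<open>z\<close> even, so the values are \<open>a\<close>, \<open>a + b\<close>,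
  \<open>a + 4 * c\<close> and \<open>a + b + 4 * c\<close> modulo 16. As \<open>b\<close> is
  \<open>4 * c\<close> or \<open>- 4 * c\<close> modulo 16, two of them coincide.\<close>

lemma residues_obstruction_16_two_even:
  "\<forall>a\<in>{2,6,10,14::int}. \<forall>b\<in>{4,12}. \<forall>c\<in>{1,3,5,7,9,11,13,15}.
     (\<exists>l\<in>{2,6,10,14}. \<forall>x\<in>{0,1,2,3}. \<forall>y\<in>{0,1,2,3}. \<forall>z\<in>{0,1,2,3}.
       (a * x^2 + b * y^2 + c * z^2 - l) mod 16 \<noteq> 0)"
  by code_simp

text \<open>Among the four classes congruent to 2 modulo 4, those with \<open>y\<close> and
  \<open>z\<close> even fill exactly three. Odd \<open>y\<close> and \<open>z\<close> reach the
  fourth just when \<open>a + b + c\<close> (if \<open>b\<close> and \<open>c\<close> agree modulo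
  4) or \<open>b + c\<close> (if they do not) is divisible by 8.\<close>

lemma residues_obstruction_16_one_even:
  "\<forall>a\<in>{2,6,10,14::int}. \<forall>b\<in>{1,3,5,7,9,11,13,15}. \<forall>c\<in>{1,3,5,7,9,11,13,15}.
     \<not> ((a + b + c) mod 8 = 0 \<or> (b + c) mod 8 = 0) \<longrightarrow>
     (\<exists>l\<in>{2,6,10,14}. \<forall>x\<in>{0,1,2,3}. \<forall>y\<in>{0,1,2,3}. \<forall>z\<in>{0,1,2,3}.
       (a * x^2 + b * y^2 + c * z^2 - l) mod 16 \<noteq> 0)"
  by code_simp

text \<open>The targets 4 and 12 are absent because they have no representation with an odd
  variable.\<close>

lemma residues_lift_16:
  "\<forall>a\<in>{2,6,10,14::int}. \<forall>b\<in>{1,3,5,7,9,11,13,15}. \<forall>c\<in>{1,3,5,7,9,11,13,15}.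
     (a + b + c) mod 8 = 0 \<or> (b + c) mod 8 = 0 \<longrightarrow>
     (\<forall>l\<in>{0,1,2,3,5,6,7,8,9,10,11,13,14,15}. \<exists>x\<in>{0,1,2,3}. \<exists>y\<in>{0,1,2,3}. \<exists>z\<in>{0,1,2,3}.
       (a * x^2 + b * y^2 + c * z^2 - l) mod 16 = 0 \<and> (odd x \<or> odd y \<or> odd z))"
  by code_simp

section \<open>Passing from residue tables to arbitrary coefficients\<close>

lemma mod_16_odd: "odd (a::int) \<Longrightarrow> a mod 16 \<in> {1,3,5,7,9,11,13,15}"
proof -
  assume "odd a"
  then have "odd (a mod 16)" by (simp add: dvd_mod_iff)
  then show ?thesis using mod_16_cases[of a] by auto
qed

lemma mod_16_of_mod_4: "(a::int) mod 4 = 2 \<Longrightarrow> a mod 16 \<in> {2,6,10,14}"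
proof -
  assume "a mod 4 = 2"
  then have "a mod 16 mod 4 = 2" by (simp add: mod_mod_cancel)
  then show ?thesis using mod_16_cases[of a] by auto
qed

lemma mod_16_of_mod_8: "(a::int) mod 8 = 4 \<Longrightarrow> a mod 16 \<in> {4,12}"
proof -
  assume "a mod 8 = 4"
  then have "a mod 16 mod 8 = 4" by (simp add: mod_mod_cancel)
  then show ?thesis using mod_16_cases[of a] by auto
qed

lemma mod_8_odd: "odd (a::int) \<Longrightarrow> a mod 8 \<in> {1,3,5,7}"
  by simp presburger

lemma mod_8_of_mod_4: "(a::int) mod 4 = 2 \<Longrightarrow> a mod 8 \<in> {2,6}"
  by simp presburger

lemma mod_8_cases: "(a::int) mod 8 \<in> {0,1,2,3,4,5,6,7}"
  by simp presburger

lemma mod_4_odd: "odd (a::int) \<Longrightarrow> a mod 4 \<in> {1,3}"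
  by simp presburger

lemma mod_4_cases: "(a::int) mod 4 \<in> {0,1,2,3}"
  by simp presburger

text \<open>Lets the side conditions of the tables modulo 8 and 16 be read on the coefficients
  themselves.\<close>

lemma sum_of_residues_mod_8:
  fixes m :: int
  assumes "8 dvd m"
  shows "(a mod m + b mod m + c mod m) mod 8 = (a + b + c) mod 8"
    and "(b mod m + c mod m) mod 8 = (b + c) mod 8"
proof -
  have *: "[x mod m = x] (mod 8)" for x
    using assms by (simp add: cong_def mod_mod_cancel)
  show "(a mod m + b mod m + c mod m) mod 8 = (a + b + c) mod 8"
    "(b mod m + c mod m) mod 8 = (b + c) mod 8"
    unfolding cong_def[symmetric] by (intro cong_add *)+
qed

lemma obstruction_of_residues:
  assumes m: "m dvd 16"
    and e: "\<exists>l\<in>L. \<forall>x\<in>{0,1,2,3}. \<forall>y\<in>{0,1,2,3}. \<forall>z\<in>{0,1,2,3}.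
      (a mod m * x^2 + b mod m * y^2 + c mod m * z^2 - l) mod m \<noteq> 0"
  shows "\<exists>l. \<not> represents_mod m a b c l"
proof -
  obtain l where "\<not> represents_mod m (a mod m) (b mod m) (c mod m) l"
    using e not_represents_modI[OF m] by blast
  then have "\<not> represents_mod m a b c l"
    by (subst represents_mod_cong[of a "a mod m" m b "b mod m" c "c mod m" l l]) simp_all
  then show ?thesis by blast
qed

lemma cong_of_residues:
  fixes m :: int
  assumes "(a mod m * x^2 + b mod m * y^2 + c mod m * z^2 - l mod m) mod m = 0"
  shows "[a * x^2 + b * y^2 + c * z^2 = l] (mod m)"
proof -
  have "[a * x^2 + b * y^2 + c * z^2 = a mod m * x^2 + b mod m * y^2 + c mod m * z^2] (mod m)"
    by (intro cong_add cong_mult cong_refl) simp_all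
  also have "[a mod m * x^2 + b mod m * y^2 + c mod m * z^2 = l mod m] (mod m)"
    using assms unfolding cong_iff_dvd_diff dvd_eq_mod_eq_0 .
  also have "[l mod m = l] (mod m)" by simp
  finally show ?thesis .
qed

lemma represents_mod_of_residues:
  assumes "\<exists>x\<in>X. \<exists>y\<in>Y. \<exists>z\<in>Z.
      (a mod m * x^2 + b mod m * y^2 + c mod m * z^2 - l mod m) mod m = 0"
  shows "represents_mod m a b c l"
  using assms by (elim bexE) (rule represents_modI, rule cong_of_residues)

section \<open>Representability and obstructions modulo 2, 4, 8 and 16\<close>

text \<open>The choice \<open>z = l\<close> works because \<open>l^2\<close> and \<open>l\<close>
  have the same parity.\<close>

lemma represents_mod_2: "odd c \<Longrightarrow> represents_mod 2 a b c l"
  by (rule represents_modI[of _ 0 _ 0 _ l]) (simp add: cong_iff_dvd_diff)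

lemma represents_mod_4_two_even:
  assumes "a mod 4 = 2" "odd c"
  shows "represents_mod 4 a b c l"
proof -
  have "a mod 4 \<in> {2}" using assms(1) by simp
  from residues_represented_4_two_even[THEN bspec, OF this, THEN bspec, OF mod_4_cases[of b],
      THEN bspec, OF mod_4_odd[OF assms(2)], THEN bspec, OF mod_4_cases[of l]]
  show ?thesis by (rule represents_mod_of_residues)
qed

lemma represents_mod_4_odd:
  assumes "odd a" "odd b" "odd c" "a mod 4 = b mod 4" "b mod 4 = c mod 4"
  shows "represents_mod 4 a b c l"
  using residues_represented_4_odd[THEN bspec, OF mod_4_odd[OF assms(1)], THEN bspec, OF mod_4_odd[OF assms(2)],
      THEN bspec, OF mod_4_odd[OF assms(3)], THEN mp, OF conjI[OF assms(4,5)], THEN bspec, OF mod_4_cases[of l]]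
  by (rule represents_mod_of_residues)

lemma represents_mod_8_two_even:
  assumes "a mod 4 = 2" "b mod 8 = 4" "odd c"
  shows "represents_mod 8 a b c l"
proof -
  have "b mod 8 \<in> {4}" using assms(2) by simp
  from residues_represented_8_two_even[THEN bspec, OF mod_8_of_mod_4[OF assms(1)], THEN bspec, OF this,
      THEN bspec, OF mod_8_odd[OF assms(3)], THEN bspec, OF mod_8_cases[of l]]
  show ?thesis by (rule represents_mod_of_residues)
qed

lemma represents_mod_8_one_even:
  assumes "a mod 4 = 2" "odd b" "odd c" "\<not> ((a + b + c) mod 8 = 0 \<or> (b + c) mod 8 = 0)"
  shows "represents_mod 8 a b c l"
proof -
  have "\<not> ((a mod 8 + b mod 8 + c mod 8) mod 8 = 0 \<or> (b mod 8 + c mod 8) mod 8 = 0)"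
    using assms(4) by (simp only: sum_of_residues_mod_8[OF dvd_refl] simp_thms)
  from residues_represented_8_one_even[THEN bspec, OF mod_8_of_mod_4[OF assms(1)], THEN bspec,
      OF mod_8_odd[OF assms(2)], THEN bspec, OF mod_8_odd[OF assms(3)], THEN mp, OF this, THEN bspec,
      OF mod_8_cases[of l]]
  show ?thesis by (rule represents_mod_of_residues)
qed

text \<open>The values modulo 4 are 0, \<open>b\<close>, \<open>c\<close> and \<open>b + c\<close>.
  As \<open>b\<close> is 0, \<open>c\<close> or \<open>- c\<close> modulo 4, two of them coincide
  and a class is missed.\<close>

lemma obstruction_4:
  assumes "4 dvd a" "4 dvd b \<or> odd b" "odd c"
  shows "\<exists>l. \<not> represents_mod 4 a b c l"
proof -
  have "a mod 4 \<in> {0}" "b mod 4 \<in> {0,1,3}"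
    using assms(1,2) mod_4_odd[of b] by auto
  from obstruction_of_residues[OF _ residues_obstruction_4[THEN bspec, OF this(1), THEN bspec, OF this(2),
      THEN bspec, OF mod_4_odd[OF assms(3)]]]
  show ?thesis by simp
qed

lemma obstruction_8_odd:
  assumes "odd a" "odd b" "odd c" "a mod 4 = b mod 4" "b mod 4 = c mod 4"
  shows "\<exists>l. \<not> represents_mod 8 a b c l"
proof -
  have "a mod 8 mod 4 = b mod 8 mod 4 \<and> b mod 8 mod 4 = c mod 8 mod 4"
    using assms(4,5) by (simp add: mod_mod_cancel)
  from obstruction_of_residues[OF _ residues_obstruction_8_odd[THEN bspec, OF mod_8_odd[OF assms(1)],
      THEN bspec, OF mod_8_odd[OF assms(2)], THEN bspec, OF mod_8_odd[OF assms(3)], THEN mp, OF this]]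
  show ?thesis by simp
qed

lemma obstruction_8_two_even:
  assumes "a mod 4 = 2" "b mod 4 = 2 \<or> b mod 8 = 0" "odd c"
  shows "\<exists>l. \<not> represents_mod 8 a b c l"
proof -
  have "b mod 8 \<in> {0,2,6}"
    using assms(2) mod_8_of_mod_4[of b] by auto
  from obstruction_of_residues[OF _ residues_obstruction_8_two_even[THEN bspec, OF mod_8_of_mod_4[OF assms(1)],
      THEN bspec, OF this, THEN bspec, OF mod_8_odd[OF assms(3)]]]
  show ?thesis by simp
qed

lemma obstruction_16_two_even:
  assumes "a mod 4 = 2" "b mod 8 = 4" "odd c"
  shows "\<exists>l. \<not> represents_mod 16 a b c l"
  using obstruction_of_residues[OF _ residues_obstruction_16_two_even[THEN bspec, OF mod_16_of_mod_4[OF assms(1)],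
      THEN bspec, OF mod_16_of_mod_8[OF assms(2)], THEN bspec, OF mod_16_odd[OF assms(3)]]]
  by simp

lemma obstruction_16_one_even:
  assumes "a mod 4 = 2" "odd b" "odd c" "\<not> ((a + b + c) mod 8 = 0 \<or> (b + c) mod 8 = 0)"
  shows "\<exists>l. \<not> represents_mod 16 a b c l"
proof -
  have "(8::int) dvd 16" by simp
  from obstruction_of_residues[OF _ residues_obstruction_16_one_even[THEN bspec, OF mod_16_of_mod_4[OF assms(1)],
      THEN bspec, OF mod_16_odd[OF assms(2)], THEN bspec, OF mod_16_odd[OF assms(3)], THEN mp,
      unfolded sum_of_residues_mod_8[OF this], OF assms(4)]]
  show ?thesis by simp
qed

section \<open>Forms without obstruction at any power of two\<close>

text \<open>Every target has a representation modulo 8 with an odd variable; moving that variable to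
  the last place lets it be lifted.\<close>

lemma represents_mod_pow2_odd:
  assumes "odd a" "odd b" "odd c" "\<not> (a mod 4 = b mod 4 \<and> b mod 4 = c mod 4)"
  shows "represents_mod (2 ^ k) a b c l"
proof -
  have "\<not> (a mod 8 mod 4 = b mod 8 mod 4 \<and> b mod 8 mod 4 = c mod 8 mod 4)"
    using assms(4) by (simp add: mod_mod_cancel)
  from residues_lift_8[THEN bspec, OF mod_8_odd[OF assms(1)],
      THEN bspec, OF mod_8_odd[OF assms(2)], THEN bspec, OF mod_8_odd[OF assms(3)], THEN mp, OF this,
      THEN bspec, OF mod_8_cases[of l]]
  obtain x y z where "(a mod 8 * x^2 + b mod 8 * y^2 + c mod 8 * z^2 - l mod 8) mod 8 = 0"
    and "odd x \<or> odd y \<or> odd z"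
    by (elim bexE conjE) (rule that)
  then have xyz: "[a * x^2 + b * y^2 + c * z^2 = l] (mod 8)" "odd x \<or> odd y \<or> odd z"
    by (auto intro: cong_of_residues)
  from xyz(2) show ?thesis
  proof (elim disjE)
    assume "odd x"
    have "[b * y^2 + c * z^2 + a * x^2 = l] (mod 8)"
      using xyz(1) by (simp add: algebra_simps)
    then have "represents_mod (2 ^ k) b c a l"
      using assms(1) \<open>odd x\<close> by (rule represents_mod_lift_two)
    then show ?thesis
      by (metis represents_mod_swap12 represents_mod_swap23)
  next
    assume "odd y"
    have "[a * x^2 + c * z^2 + b * y^2 = l] (mod 8)"
      using xyz(1) by (simp add: algebra_simps)
    then have "represents_mod (2 ^ k) a c b l"
      using assms(2) \<open>odd y\<close> by (rule represents_mod_lift_two)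
    then show ?thesis
      by (metis represents_mod_swap23)
  next
    assume "odd z"
    with xyz(1) assms(3) show ?thesis by (rule represents_mod_lift_two)
  qed
qed

text \<open>For \<open>l mod 8 = 4\<close> every representation of \<open>l\<close> has all its variables even, so no variable is
  available for Hensel lifting; such \<open>l\<close> are reached by doubling a representation of
  \<open>l div 4\<close>.\<close>

lemma represents_mod_pow2_one_even:
  assumes "a mod 4 = 2" "odd b" "odd c" "(a + b + c) mod 8 = 0 \<or> (b + c) mod 8 = 0"
  shows "represents_mod (2 ^ k) a b c l"
proof -
  have eight: "(8::int) dvd 16" by simp
  have primitive: "represents_mod (2 ^ k) a b c l" if "l mod 8 \<noteq> 4" for l
  proof -
    have "l mod 16 mod 8 \<noteq> 4"
      using that by (simp add: mod_mod_cancel)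
    then have "l mod 16 \<in> {0,1,2,3,5,6,7,8,9,10,11,13,14,15}"
      using mod_16_cases[of l] by auto
    from residues_lift_16[THEN bspec, OF mod_16_of_mod_4[OF assms(1)],
      THEN bspec, OF mod_16_odd[OF assms(2)], THEN bspec, OF mod_16_odd[OF assms(3)], THEN mp,
      unfolded sum_of_residues_mod_8[OF eight], OF assms(4), THEN bspec, OF this]
    obtain x y z where "(a mod 16 * x^2 + b mod 16 * y^2 + c mod 16 * z^2 - l mod 16) mod 16 = 0"
    and "odd x \<or> odd y \<or> odd z"
    by (elim bexE conjE) (rule that)
  then have xyz: "[a * x^2 + b * y^2 + c * z^2 = l] (mod 16)" "odd x \<or> odd y \<or> odd z"
    by (auto intro: cong_of_residues)
    from xyz(1) have xyz8: "[a * x^2 + b * y^2 + c * z^2 = l] (mod 8)"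
      by (rule cong_dvd_modulus) simp
    from xyz(2) show ?thesis
    proof (elim disjE)
      \<comment> \<open>The coefficient \<open>a\<close> is twice an odd number, so lifting
        \<open>x\<close> uses the congruence modulo 16; for \<open>y\<close> and \<open>z\<close>
        the one modulo 8 suffices.\<close>
      assume "odd x"
      have "[b * y^2 + c * z^2 + a * x^2 = l] (mod 16)"
        using xyz(1) by (simp add: algebra_simps)
      then have "represents_mod (2 ^ k) b c a l"
        using \<open>odd x\<close> assms(1) by (intro represents_mod_lift_two_even) (auto simp: cong_def)
      then show ?thesis
        by (metis represents_mod_swap12 represents_mod_swap23)
    next
      assume "odd y"
      have "[a * x^2 + c * z^2 + b * y^2 = l] (mod 8)"
        using xyz8 by (simp add: algebra_simps)
      then have "represents_mod (2 ^ k) a c b l"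
        using assms(2) \<open>odd y\<close> by (rule represents_mod_lift_two)
      then show ?thesis
        by (metis represents_mod_swap23)
    next
      assume "odd z"
      with xyz8 assms(3) show ?thesis by (rule represents_mod_lift_two)
    qed
  qed
  show ?thesis
  proof (cases "l mod 8 = 4")
    case True
    \<comment> \<open>Here \<open>l div 4\<close> is odd, so it falls under the primitive
      case.\<close>
    then have "l = 4 * (l div 4) \<and> (l div 4) mod 8 \<noteq> 4"
      by presburger
    then obtain n where n: "l = 4 * n" "n mod 8 \<noteq> 4" by blast
    obtain x y z where "[a * x^2 + b * y^2 + c * z^2 = n] (mod 2 ^ k)"
      using primitive[OF n(2)] by (rule represents_modE)
    then have "[4 * (a * x^2 + b * y^2 + c * z^2) = l] (mod 2 ^ k)"
      unfolding n(1) by (rule cong_scalar_left)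
    then show ?thesis
      by (intro represents_modI[of _ "2 * x" _ "2 * y" _ "2 * z"]) (simp add: power_mult_distrib algebra_simps)
  qed (rule primitive)
qed


subsection \<open>The minimal obstruction modulus\<close>

lemma num_divisible_eq:
  "num_divisible m a b c = of_bool (m dvd a) + of_bool (m dvd b) + of_bool (m dvd c)"
  by (simp add: num_divisible_def)

text \<open>Isolates the condition inside \<open>q_min\<close>, so that its symmetry can be proved
  once.\<close>

definition nonresidue_prime :: "int \<Rightarrow> int \<Rightarrow> int \<Rightarrow> nat \<Rightarrow> bool" where
  "nonresidue_prime a b c q \<longleftrightarrow> prime q \<and> odd q \<and> num_divisible (int q) a b c = 1 \<and>
      (int q dvd a \<and> Legendre (- (b * c)) (int q) = -1 \<or>
       int q dvd b \<and> Legendre (- (a * c)) (int q) = -1 \<or>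
       int q dvd c \<and> Legendre (- (a * b)) (int q) = -1)"

lemma q_min_eq: "q_min a b c = (INF q \<in> Collect (nonresidue_prime a b c). enat q)"
  unfolding q_min_def nonresidue_prime_def ..

section \<open>Permutation invariance and obstructions at odd primes\<close>

lemma local_obstruction_swap12:
  "local_obstruction (diag_form a b c) k = local_obstruction (diag_form b a c) k"
  unfolding local_obstruction_diag_form by (simp add: represents_mod_swap12[of _ a])

lemma local_obstruction_swap23:
  "local_obstruction (diag_form a b c) k = local_obstruction (diag_form a c b) k"
  unfolding local_obstruction_diag_form by (simp add: represents_mod_swap23[of _ _ b])

lemma num_divisible_swap:
  "num_divisible m a b c = num_divisible m b a c"
  "num_divisible m a b c = num_divisible m a c b"
  by (simp_all add: num_divisible_eq)

lemma nonresidue_prime_swap: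
  "nonresidue_prime a b c = nonresidue_prime b a c"
  "nonresidue_prime a b c = nonresidue_prime a c b"
  by (auto simp: fun_eq_iff nonresidue_prime_def num_divisible_eq mult.commute)

lemma Legendre_eq_minus_1_iff:
  "prime p \<Longrightarrow> \<not> p dvd n \<Longrightarrow> Legendre n p = - 1 \<longleftrightarrow> \<not> QuadRes p n"
  by (auto simp: Legendre_def cong_0_iff)

lemma nonresidue_prime_obstruction:
  assumes "nonresidue_prime a b c q"
  shows "local_obstruction (diag_form a b c) (q^2)"
proof -
  \<comment> \<open>The coefficients are generic here, so the other two positions of the prime
    follow by permutation.\<close>
  have *: "local_obstruction (diag_form a b c) (q^2)"
    if q: "prime q" "num_divisible (int q) a b c = 1" "int q dvd a" "Legendre (- (b * c)) (int q) = - 1" for a b c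
  proof -
    have "\<not> int q dvd b" "\<not> int q dvd c"
      using q by (auto simp: num_divisible_eq of_bool_def split: if_splits)
    moreover have "\<not> QuadRes (int q) (- (b * c))"
      using q(4) by (auto simp: Legendre_def split: if_splits)
    ultimately show ?thesis
      using not_represents_mod_square[of "int q"] q by (simp add: local_obstruction_diag_form)
  qed
  from assms show ?thesis
    unfolding nonresidue_prime_def
    using *[of a b c] *[of b a c] *[of c a b] local_obstruction_swap12 local_obstruction_swap23 num_divisible_swap
    by metis
qed

lemma prime_dividing_two_obstruction:
  assumes q: "prime q" "odd q" "num_divisible (int q) a b c = 2"
  shows "local_obstruction (diag_form a b c) q"
proof -
  have *: "local_obstruction (diag_form a b c) q"
    if "int q dvd a" "int q dvd b" "\<not> int q dvd c" for a b c
    using not_represents_mod_prime[of "int q" a b c] that q by (simp add: local_obstruction_diag_form)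
  have "int q dvd a \<and> int q dvd b \<and> \<not> int q dvd c \<or> int q dvd a \<and> int q dvd c \<and> \<not> int q dvd b
    \<or> int q dvd b \<and> int q dvd c \<and> \<not> int q dvd a"
    using q(3) by (auto simp: num_divisible_eq of_bool_def split: if_splits)
  then show ?thesis
    using *[of a b c] *[of a c b] *[of b c a] local_obstruction_swap12 local_obstruction_swap23 by metis
qed

text \<open>Coprimality and the unit case leave one or two coefficients divisible by
  \<open>p\<close>. If there is one, the isotropic case is excluded, and \<open>e = 1\<close> is
  impossible because the other two coefficients already give a universal binary form modulo
  \<open>p\<close>.\<close>

lemma odd_prime_power_obstruction:
  assumes p: "prime p" "odd p" and coprime: "gcd a (gcd b c) = 1"
    and obstruction: "local_obstruction (diag_form a b c) (p ^ e)"
  shows "e \<ge> 1 \<and> num_divisible (int p) a b c = 2 \<or> e \<ge> 2 \<and> nonresidue_prime a b c p"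
proof -
  have e: "e \<ge> 1"
    using obstruction by (cases e) (auto simp: local_obstruction_def)
  have P: "prime (int p)" "odd (int p)" using p by auto
  have "\<not> (int p dvd a \<and> int p dvd b \<and> int p dvd c)"
    using coprime P(1) by (metis gcd_greatest not_prime_unit)
  moreover obtain l where "\<not> represents_mod (int p ^ e) a b c l"
    using obstruction by (auto simp: local_obstruction_diag_form)
  then have "int p dvd a \<or> int p dvd b \<or> int p dvd c"
    using represents_mod_prime_power_unit[OF P] by blast
  ultimately have n: "num_divisible (int p) a b c = 1 \<or> num_divisible (int p) a b c = 2"
    by (auto simp: num_divisible_eq of_bool_def split: if_splits)
  have *: "e \<ge> 2 \<and> nonresidue_prime a b c p"
    if d: "int p dvd a" "num_divisible (int p) a b c = 1" "local_obstruction (diag_form a b c) (p ^ e)" for a b c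
  proof -
    have bc: "\<not> int p dvd b" "\<not> int p dvd c"
      using d by (auto simp: num_divisible_eq of_bool_def split: if_splits)
    obtain l where l: "\<not> represents_mod (int p ^ e) a b c l"
      using d(3) by (auto simp: local_obstruction_diag_form)
    have "\<not> QuadRes (int p) (- (b * c))"
      using represents_mod_prime_power_isotropic[OF P bc] l by blast
    then have "nonresidue_prime a b c p"
      using p d P bc by (simp add: nonresidue_prime_def Legendre_eq_minus_1_iff prime_dvd_mult_iff)
    moreover have "e \<noteq> 1"
    proof
      assume "e = 1"
      obtain x y where "[b * x^2 + c * y^2 = l] (mod int p)"
        using binary_form_represents_mod_prime[OF P bc] by blast
      then have "represents_mod (int p) a b c l"
        by (intro represents_modI[of _ 0 _ x _ y]) simp
      with l \<open>e = 1\<close> show False by simp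
    qed
    ultimately show ?thesis using e by simp
  qed
  show ?thesis
  proof (cases "num_divisible (int p) a b c = 2")
    case False
    then have one: "num_divisible (int p) a b c = 1" using n by simp
    then have "int p dvd a \<or> int p dvd b \<or> int p dvd c"
      by (auto simp: num_divisible_eq of_bool_def split: if_splits)
    then show ?thesis
      using *[of a b c] *[of b a c] *[of c a b] one obstruction
      by (metis local_obstruction_swap12 local_obstruction_swap23 num_divisible_swap nonresidue_prime_swap)
  qed (use e in simp)
qed

section \<open>The minimum over all moduli\<close>

text \<open>By well-ordering; bounding by the square of \<open>q_min\<close> requires an actual
  prime attaining it.\<close>

lemma INF_enat_attained:
  assumes "S \<noteq> {}"
  shows "\<exists>k\<in>S. (INF k\<in>S. enat k) = enat k"
proof -
  have "(INF k\<in>S. enat k) \<in> enat ` S"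
    using assms wellorder_InfI[of _ "enat ` S"] by blast
  then show ?thesis by blast
qed

lemma kappa_le: "k \<ge> 1 \<Longrightarrow> local_obstruction Q k \<Longrightarrow> kappa Q \<le> enat k"
  unfolding kappa_def by (intro INF_lower) simp

lemma kappa_le_p_min: "kappa (diag_form a b c) \<le> p_min a b c"
  unfolding p_min_def
  by (intro INF_greatest kappa_le) (auto intro: prime_dividing_two_obstruction simp: Suc_le_eq prime_gt_0_nat)

lemma kappa_le_q_min: "kappa (diag_form a b c) \<le> (q_min a b c)^2"
proof (cases "Collect (nonresidue_prime a b c) = {}")
  case True
  have "q_min a b c = \<infinity>"
    unfolding q_min_eq True by (simp add: top_enat_def)
  then show ?thesis by (simp add: power2_eq_square)
next
  case False
  then obtain q where q: "nonresidue_prime a b c q" "q_min a b c = enat q"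
    using INF_enat_attained[OF False] by (auto simp: q_min_eq)
  moreover have "q > 0"
    using q(1) by (simp add: nonresidue_prime_def prime_gt_0_nat)
  ultimately show ?thesis
    using kappa_le[OF _ nonresidue_prime_obstruction[OF q(1)]] by (simp add: power2_eq_square Suc_le_eq)
qed

lemma q_min_square_ge: "9 \<le> (q_min a b c)^2"
proof -
  have "enat 3 \<le> q_min a b c"
    unfolding q_min_eq
  proof (rule INF_greatest)
    fix q assume "q \<in> Collect (nonresidue_prime a b c)"
    then have "prime q" "odd q" by (auto simp: nonresidue_prime_def)
    then show "enat 3 \<le> enat q"
      using prime_ge_2_nat[of q] by (cases "q = 2") auto
  qed
  then have "enat 3 * enat 3 \<le> q_min a b c * q_min a b c"
    by (intro mult_mono) auto
  then show ?thesis
    by (simp add: power2_eq_square numeral_eq_enat)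
qed

text \<open>The parameter \<open>t\<close> is the least power of two giving an obstruction, or \<open>\<infinity>\<close>.\<close>

lemma kappa_eq_min:
  assumes coprime: "gcd a (gcd b c) = 1"
    and lower: "\<And>e. local_obstruction (diag_form a b c) (2 ^ e) \<Longrightarrow> t \<le> enat (2 ^ e)"
    and attained: "kappa (diag_form a b c) \<le> t"
  shows "kappa (diag_form a b c) = min t (min (p_min a b c) ((q_min a b c)^2))"
proof (rule antisym)
  show "kappa (diag_form a b c) \<le> min t (min (p_min a b c) ((q_min a b c)^2))"
    using attained kappa_le_p_min kappa_le_q_min by simp
  show "min t (min (p_min a b c) ((q_min a b c)^2)) \<le> kappa (diag_form a b c)"
    unfolding kappa_def
  proof (rule INF_greatest)
    fix k assume "k \<in> {k. 1 \<le> k \<and> local_obstruction (diag_form a b c) k}"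
    then have k: "1 \<le> k" "local_obstruction (diag_form a b c) k" by auto
    then obtain p e where pe: "prime p" "p ^ e dvd k" "local_obstruction (diag_form a b c) (p ^ e)"
      using local_obstruction_prime_power by blast
    have pos: "p \<ge> 1" using pe(1) prime_gt_0_nat[of p] by simp
    \<comment> \<open>Bounding the prime power is enough, since it divides \<open>k\<close>.\<close>
    have "min t (min (p_min a b c) ((q_min a b c)^2)) \<le> enat (p ^ e)"
    proof (cases "p = 2")
      case True
      then show ?thesis using lower[of e] pe by (simp add: min.coboundedI1)
    next
      case False
      then have "odd p"
        using pe(1) prime_odd_nat[of p] prime_ge_2_nat[of p] by simp
      then consider "e \<ge> 1" "num_divisible (int p) a b c = 2" | "e \<ge> 2" "nonresidue_prime a b c p"
        using odd_prime_power_obstruction[OF pe(1) _ coprime pe(3)] by blast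
      then show ?thesis
      proof cases
        case 1
        then have "p_min a b c \<le> enat p"
          unfolding p_min_def using pe(1) \<open>odd p\<close> by (intro INF_lower) simp
        also have "p \<le> p ^ e" using power_increasing[OF 1(1) pos] by simp
        finally show ?thesis by (simp add: min.coboundedI1 min.coboundedI2)
      next
        case 2
        then have "q_min a b c \<le> enat p"
          unfolding q_min_eq by (intro INF_lower) simp
        then have "(q_min a b c)^2 \<le> enat (p^2)"
          using mult_mono[of "q_min a b c" "enat p" "q_min a b c" "enat p"] by (simp add: power2_eq_square)
        also have "p^2 \<le> p ^ e" using power_increasing[OF 2(1) pos] .
        finally show ?thesis by (simp add: min.coboundedI2)
      qed
    qed
    also have "p ^ e \<le> k" using pe(2) k(1) by (intro dvd_imp_le) auto
    finally show "min t (min (p_min a b c) ((q_min a b c)^2)) \<le> enat k" by simp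
  qed
qed

text \<open>Representability modulo \<open>2 ^ n\<close> passes to all smaller powers, so
  \<open>2 ^ Suc n\<close> is the first power of two that obstructs.\<close>

lemma kappa_two_obstruction:
  assumes coprime: "gcd a (gcd b c) = 1"
    and represented: "\<And>l. represents_mod (2 ^ n) a b c l"
    and obstruction: "\<exists>l. \<not> represents_mod (2 ^ Suc n) a b c l"
  shows "kappa (diag_form a b c) = min (2 ^ Suc n) (min (p_min a b c) ((q_min a b c)^2))"
proof (rule kappa_eq_min[OF coprime])
  have pow: "(2::enat) ^ k = enat (2 ^ k)" for k
    by (metis of_nat_eq_enat of_nat_numeral of_nat_power)
  show "kappa (diag_form a b c) \<le> 2 ^ Suc n"
    unfolding pow using obstruction by (intro kappa_le) (simp_all add: local_obstruction_diag_form)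
  fix e assume "local_obstruction (diag_form a b c) (2 ^ e)"
  then have "\<not> e \<le> n"
    using represents_mod_dvd[OF represented le_imp_power_dvd] by (auto simp: local_obstruction_diag_form)
  then show "2 ^ Suc n \<le> enat (2 ^ e)"
    unfolding pow enat_ord_simps by (intro power_increasing) auto
qed

text \<open>With \<open>\<infinity>\<close> as the two-adic bound, the condition on powers of two
  holds vacuously.\<close>

lemma kappa_no_two_obstruction:
  assumes coprime: "gcd a (gcd b c) = 1"
    and represented: "\<And>k l. represents_mod (2 ^ k) a b c l"
  shows "kappa (diag_form a b c) = min (p_min a b c) ((q_min a b c)^2)"
  using kappa_eq_min[OF coprime, of "\<infinity>"] represented
  by (simp add: local_obstruction_diag_form)

text \<open>The obstructing power is at most 8, below the bound 9 for the square of
  \<open>q_min\<close>, which drops out of the minimum.\<close>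

lemma kappa_two_obstruction_small:
  assumes "gcd a (gcd b c) = 1" "\<And>l. represents_mod (2 ^ n) a b c l" "\<exists>l. \<not> represents_mod (2 ^ Suc n) a b c l"
    and "n \<le> 2"
  shows "kappa (diag_form a b c) = min (2 ^ Suc n) (p_min a b c)"
proof -
  have "(2::enat) ^ Suc n \<le> 2 ^ 3"
    using assms(4) by (intro power_increasing) auto
  also have "\<dots> \<le> 9" by simp
  also have "\<dots> \<le> (q_min a b c)^2" by (rule q_min_square_ge)
  finally show ?thesis
    unfolding kappa_two_obstruction[OF assms(1-3)] by (auto simp: min_def)
qed

text \<open>The two adjacent transpositions generate all permutations of three coefficients.\<close>

lemma coefficient_symmetric:
  assumes mset: "mset [a, b, c] = mset [a1, a2, a3]"
    and swap: "\<And>a b c. f a b c = f b a c" "\<And>a b c. f a b c = f a c b"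
  shows "f a1 a2 a3 = f a b c"
proof -
  have "a1 = a \<and> a2 = b \<and> a3 = c \<or> a1 = b \<and> a2 = a \<and> a3 = c \<or> a1 = a \<and> a2 = c \<and> a3 = b
    \<or> a1 = b \<and> a2 = c \<and> a3 = a \<or> a1 = c \<and> a2 = a \<and> a3 = b \<or> a1 = c \<and> a2 = b \<and> a3 = a"
    using mset by (auto simp: add_eq_conv_ex add_mset_eq_single)
  then show ?thesis
    by (elim disjE conjE; metis swap)
qed

theorem corollary1p6:
  fixes a1 a2 a3 a b c :: int
  assumes pos: "a1 > 0" "a2 > 0" "a3 > 0"
    and coprime: "gcd a1 (gcd a2 a3) = 1"
    and labelling: "mset [a, b, c] = mset [a1, a2, a3]"
  shows
    "(odd a \<and> odd b \<and> odd c \<longrightarrow>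
       kappa (diag_form a1 a2 a3) =
         (if [a = b] (mod 4) \<and> [b = c] (mod 4)
          then min 8 (p_min a1 a2 a3)
          else min (p_min a1 a2 a3) ((q_min a1 a2 a3)^2)))
     \<and>
     (even a \<and> even b \<and> odd c \<and>
        ([a = 2] (mod 4) \<noteq> [b = 2] (mod 4) \<longrightarrow> [a = 2] (mod 4)) \<longrightarrow>
       (4 dvd a \<and> 4 dvd b \<longrightarrow>
         kappa (diag_form a1 a2 a3) = min 4 (p_min a1 a2 a3)) \<and>
       ([a = 2] (mod 4) \<and> [b = 2] (mod 4) \<or> [a = 2] (mod 4) \<and> [b = 0] (mod 8) \<longrightarrow>
         kappa (diag_form a1 a2 a3) = min 8 (p_min a1 a2 a3)) \<and>
       ([a = 2] (mod 4) \<and> [b = 4] (mod 8) \<longrightarrow>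
         kappa (diag_form a1 a2 a3) = min 16 (min (p_min a1 a2 a3) ((q_min a1 a2 a3)^2))))
     \<and>
     (even a \<and> odd b \<and> odd c \<longrightarrow>
       kappa (diag_form a1 a2 a3) =
         (if 4 dvd a then min 4 (p_min a1 a2 a3)
          else if [a = 2] (mod 4) \<and> [a + b + c = 0] (mod 8) \<or>
                  [a = 2] (mod 4) \<and> [b + c = 0] (mod 8)
          then min (p_min a1 a2 a3) ((q_min a1 a2 a3)^2)
          else min 16 (min (p_min a1 a2 a3) ((q_min a1 a2 a3)^2))))"
proof -
  \<comment> \<open>All quantities involved are symmetric, so the claim may be proved for the
    labelled coefficients.\<close>
  have kappa: "kappa (diag_form a1 a2 a3) = kappa (diag_form a b c)"
    using labelling
    by (rule coefficient_symmetric)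
      (simp_all only: kappa_def local_obstruction_swap12 local_obstruction_swap23)
  have p: "p_min a1 a2 a3 = p_min a b c"
    using labelling
    by (rule coefficient_symmetric)
      (simp_all only: p_min_def num_divisible_swap)
  have q: "q_min a1 a2 a3 = q_min a b c"
    using labelling
    by (rule coefficient_symmetric)
      (metis q_min_eq nonresidue_prime_swap)+
  have "gcd a1 (gcd a2 a3) = gcd a (gcd b c)"
    using labelling
    by (rule coefficient_symmetric[where f = "\<lambda>a b c. gcd a (gcd b c)"])
      (simp_all add: gcd.commute gcd.left_commute)
  with coprime have coprime: "gcd a (gcd b c) = 1" by simp
  show ?thesis
    unfolding kappa p q cong_def
  proof (intro conjI impI)
    assume odd: "odd a \<and> odd b \<and> odd c"
    show "kappa (diag_form a b c) = (if a mod 4 = b mod 4 \<and> b mod 4 = c mod 4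
      then min 8 (p_min a b c) else min (p_min a b c) ((q_min a b c)^2))"
    proof (cases "a mod 4 = b mod 4 \<and> b mod 4 = c mod 4")
      case True
      then show ?thesis
        \<comment> \<open>Nothing is missed modulo 4, and 8 is the next power.\<close>
        using kappa_two_obstruction_small[OF coprime, of 2] represents_mod_4_odd[of a b c] obstruction_8_odd[of a b c] odd
        by simp
    next
      case False
      then have "kappa (diag_form a b c) = min (p_min a b c) ((q_min a b c)^2)"
        using represents_mod_pow2_odd[of a b c] odd by (intro kappa_no_two_obstruction[OF coprime]) blast
      then show ?thesis by (simp only: False if_False)
    qed
  next
    assume "even a \<and> even b \<and> odd c \<and> ((a mod 4 = 2 mod 4) \<noteq> (b mod 4 = 2 mod 4) \<longrightarrow> a mod 4 = 2 mod 4)"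
    then have c: "odd c" by simp
    show "kappa (diag_form a b c) = min 4 (p_min a b c)" if "4 dvd a \<and> 4 dvd b"
      using kappa_two_obstruction_small[OF coprime, of 1] represents_mod_2[OF c] obstruction_4[of a b c] that c
      by simp
    show "kappa (diag_form a b c) = min 8 (p_min a b c)"
      if "a mod 4 = 2 mod 4 \<and> b mod 4 = 2 mod 4 \<or> a mod 4 = 2 mod 4 \<and> b mod 8 = 0 mod 8"
      using kappa_two_obstruction_small[OF coprime, of 2] represents_mod_4_two_even[of a c b]
        obstruction_8_two_even[of a b c] that c
      by auto
    show "kappa (diag_form a b c) = min 16 (min (p_min a b c) ((q_min a b c)^2))"
      if "a mod 4 = 2 mod 4 \<and> b mod 8 = 4 mod 8"
      \<comment> \<open>Since 16 exceeds 9, the square of \<open>q_min\<close> may be smaller and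
        stays in the minimum.\<close>
      using kappa_two_obstruction[OF coprime, of 3] represents_mod_8_two_even[of a b c]
        obstruction_16_two_even[of a b c] that c
      by simp
  next
    assume "even a \<and> odd b \<and> odd c"
    then have a: "even a" and bc: "odd b" "odd c" by auto
    show "kappa (diag_form a b c) = (if 4 dvd a then min 4 (p_min a b c)
      else if a mod 4 = 2 mod 4 \<and> (a + b + c) mod 8 = 0 mod 8 \<or> a mod 4 = 2 mod 4 \<and> (b + c) mod 8 = 0 mod 8
      then min (p_min a b c) ((q_min a b c)^2) else min 16 (min (p_min a b c) ((q_min a b c)^2)))"
    proof (cases "4 dvd a")
      case True
      then show ?thesis
        using kappa_two_obstruction_small[OF coprime, of 1] represents_mod_2[OF bc(2)] obstruction_4[of a b c] bc
        by simp
    next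
      case False
      with a have a4: "a mod 4 = 2" by presburger
      show ?thesis
      proof (cases "(a + b + c) mod 8 = 0 \<or> (b + c) mod 8 = 0")
        case True
        then have "kappa (diag_form a b c) = min (p_min a b c) ((q_min a b c)^2)"
          by (intro kappa_no_two_obstruction[OF coprime] represents_mod_pow2_one_even[OF a4 bc])
        then show ?thesis using True False a4 by auto
      next
        case no: False
        then have "kappa (diag_form a b c) = min 16 (min (p_min a b c) ((q_min a b c)^2))"
          using kappa_two_obstruction[OF coprime, of 3] represents_mod_8_one_even[OF a4 bc]
            obstruction_16_one_even[OF a4 bc]
          by simp
        then show ?thesis using no False by auto
      qed
    qed
  qed
qed

end
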